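(* Let $m\in\mathbb{N}_0$ and let $r$ be an even integer. Then \[ \int_0^\infty \frac{\ln x\sum_{j=0}^{m+1}\binom{m+1}{j}L_{2rj}\,x^{2m+1-j}}{(x-1)(x^2+L_{2r}x+1)^{m+1}}\,dx = \frac{L_{r(m+1)}}{2L_r^{m+1}}(\pi^2+4r^2\ln^2\alpha) + \frac{1}{L_r^m}\sum_{j=0}^{m-1}\frac{L_r^j}{j+1}\left(L_{r(m-j)}H_j - 2\sqrt5\, r\ln\alpha\, F_{r(m-j)}\right), \] and \[ \int_0^\infty \frac{\ln x\sum_{j=0}^{m+1}\binom{m+1}{j}F_{2rj}\,x^{2m+1-j}}{(x-1)(x^2+L_{2r}x+1)^{m+1}}\,dx = \frac{F_{r(m+1)}}{2L_r^{m+1}}(\pi^2+4r^2\ln^2\alpha) + \frac{1}{L_r^m}\sum_{j=0}^{m-1}\frac{L_r^j}{j+1}\left(F_{r(m-j)}H_j - \frac{2\sqrt5}{5}\, r\ln\alpha\, L_{r(m-j)}\right). \]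
   Context: $F_n$ and $L_n$ are the Fibonacci and Lucas numbers ($F_0=0,F_1=1,F_{n+1}=F_n+F_{n-1}$; $L_0=2,L_1=1,L_{n+1}=L_n+L_{n-1}$, extended to all integers by the same recurrence), and $\alpha=(1+\sqrt5)/2$ is the golden ratio. $H_n=\sum_{i=1}^n \frac1i$ is the $n$-th harmonic number, $H_0=0$. Empty sums are zero. *)

theory Defs
  imports "HOL-Analysis.Analysis"
begin

function fibZ :: "int \<Rightarrow> int" where
  "fibZ n = (if n = 0 then 0 else if n = 1 then 1
             else if n > 1 then fibZ (n - 1) + fibZ (n - 2)
             else fibZ (n + 2) - fibZ (n + 1))"
  by pat_completeness auto
termination
  by (relation "Wellfounded.measure (\<lambda>n. nat (if n < 0 then 1 - n else n))") auto

function lucasZ :: "int \<Rightarrow> int" where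
  "lucasZ n = (if n = 0 then 2 else if n = 1 then 1
               else if n > 1 then lucasZ (n - 1) + lucasZ (n - 2)
               else lucasZ (n + 2) - lucasZ (n + 1))"
  by pat_completeness auto
termination
  by (relation "Wellfounded.measure (\<lambda>n. nat (if n < 0 then 1 - n else n))") auto

declare fibZ.simps [simp del] lucasZ.simps [simp del]

lemma fibZ_0 [simp]: "fibZ 0 = 0" and fibZ_1 [simp]: "fibZ 1 = 1"
  by (simp_all add: fibZ.simps)

lemma lucasZ_0 [simp]: "lucasZ 0 = 2" and lucasZ_1 [simp]: "lucasZ 1 = 1"
  by (simp_all add: lucasZ.simps)

lemma fibZ_rec: "fibZ (n + 1) = fibZ n + fibZ (n - 1)"
proof (cases "n > 0")
  case True
  then show ?thesis using fibZ.simps[of "n + 1"] by simp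
next
  case False
  then have "fibZ (n - 1) = fibZ (n + 1) - fibZ n"
    using fibZ.simps[of "n - 1"] by (simp add: add.commute)
  then show ?thesis by simp
qed

lemma lucasZ_rec: "lucasZ (n + 1) = lucasZ n + lucasZ (n - 1)"
proof (cases "n > 0")
  case True
  then show ?thesis using lucasZ.simps[of "n + 1"] by simp
next
  case False
  then have "lucasZ (n - 1) = lucasZ (n + 1) - lucasZ n"
    using lucasZ.simps[of "n - 1"] by (simp add: add.commute)
  then show ?thesis by simp
qed

definition golden_ratio :: real where
  "golden_ratio = (1 + sqrt 5) / 2"

end

theory Submission
  imports Defs "HOL-Real_Asymp.Real_Asymp"
begin

text \<open>
  Put \<open>a = \<alpha>\<^sup>2\<^sup>r\<close>. Since \<open>r\<close> is even, \<open>L\<^sub>2\<^sub>r = a + 1/a\<close>, so the quadratic in the denominator is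
  \<open>(x + a) (x + 1/a)\<close>. By Binet and the binomial theorem both integrands are linear combinations
  of \<open>x\<^sup>m ln x / ((x - 1) (x + b)\<^sup>m\<^sup>+\<^sup>1)\<close> with \<open>b = a\<close> and \<open>b = 1/a\<close>. Let \<open>I\<^sub>m(b)\<close> be the
  integral of this kernel. Partial fractions give the recurrence
  \<open>(1 + b) I\<^sub>m(b) = I\<^sub>m\<^sub>-\<^sub>1(b) + (ln b + H\<^sub>m\<^sub>-\<^sub>1) / m\<close>, whose inhomogeneity has an elementary
  antiderivative.

  For \<open>I\<^sub>0(b) = (\<pi>\<^sup>2 + ln\<^sup>2 b) / (2 (1 + b))\<close>, the case \<open>b = 1\<close> follows from the geometric series
  and \<open>\<Sum> 1 / (2n + 1)\<^sup>2 = \<pi>\<^sup>2 / 8\<close>. The general case differs from it by the integral of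
  \<open>ln x (1/(x + 1) - 1/(x + b))\<close>. If \<open>P\<close> is an antiderivative of \<open>ln x / (x + 1)\<close>, then
  \<open>P(x) - P(x/b) - ln b ln(x + b)\<close> is one for this function, and its limits at \<open>0\<close> and \<open>\<infinity>\<close>
  come from the mean value theorem, without evaluating the dilogarithm.
\<close>

section \<open>Improper integrals from one-sided limits of an antiderivative\<close>

text \<open>For a nonnegative integrand the limits of the antiderivative already force Lebesgue
  integrability. This carries that form of the fundamental theorem over to
  \<open>has_integral\<close>.\<close>

lemma has_integral_FTC_nonneg_einterval:
  fixes f F :: "real \<Rightarrow> real" and a b :: ereal
  assumes "a < b"
    and F: "\<And>x. a < ereal x \<Longrightarrow> ereal x < b \<Longrightarrow> (F has_real_derivative f x) (at x)"
    and f: "\<And>x. a < ereal x \<Longrightarrow> ereal x < b \<Longrightarrow> isCont f x"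
    and nonneg: "\<And>x. a < ereal x \<Longrightarrow> ereal x < b \<Longrightarrow> 0 \<le> f x"
    and A: "((F \<circ> real_of_ereal) \<longlongrightarrow> A) (at_right a)"
    and B: "((F \<circ> real_of_ereal) \<longlongrightarrow> B) (at_left b)"
  shows "(f has_integral (B - A)) (einterval a b)"
proof -
  have ae: "AE x in lborel. a < ereal x \<longrightarrow> ereal x < b \<longrightarrow> 0 \<le> f x"
    using nonneg by simp
  note * = interval_integral_FTC_nonneg[OF \<open>a < b\<close> F f ae A B]
  have "integral (einterval a b) f = B - A"
    using *(2) set_borel_integral_eq_integral(2)[OF *(1)] \<open>a < b\<close>
    by (simp add: interval_lebesgue_integral_def less_imp_le)
  with set_borel_integral_eq_integral(1)[OF *(1)] show ?thesis
    by (metis integrable_integral)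
qed

lemma has_integral_FTC_nonneg_unit:
  fixes f F :: "real \<Rightarrow> real"
  assumes "\<And>x. 0 < x \<Longrightarrow> x < 1 \<Longrightarrow> (F has_real_derivative f x) (at x)"
    and "\<And>x. 0 < x \<Longrightarrow> x < 1 \<Longrightarrow> isCont f x"
    and "\<And>x. 0 < x \<Longrightarrow> x < 1 \<Longrightarrow> 0 \<le> f x"
    and "(F \<longlongrightarrow> A) (at_right 0)" and "(F \<longlongrightarrow> B) (at_left 1)"
  shows "(f has_integral (B - A)) {0<..<1}"
  using has_integral_FTC_nonneg_einterval[of "ereal 0" "ereal 1" F f A B] assms
  unfolding ereal_tendsto_simps1 einterval_eq by simp

lemma has_integral_FTC_nonneg_above_1:
  fixes f F :: "real \<Rightarrow> real"
  assumes "\<And>x. 1 < x \<Longrightarrow> (F has_real_derivative f x) (at x)"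
    and "\<And>x. 1 < x \<Longrightarrow> isCont f x"
    and "\<And>x. 1 < x \<Longrightarrow> 0 \<le> f x"
    and "(F \<longlongrightarrow> A) (at_right 1)" and "(F \<longlongrightarrow> B) at_top"
  shows "(f has_integral (B - A)) {1<..}"
  using has_integral_FTC_nonneg_einterval[of "ereal 1" "\<infinity>" F f A B] assms
  unfolding ereal_tendsto_simps1 einterval_eq by simp

text \<open>The two open pieces miss only the point 1, a null set. So nothing is asked of
  \<open>f\<close> at 1, where the integrands below have a removable singularity or change
  sign.\<close>

lemma has_integral_halfline_split_1:
  fixes f :: "real \<Rightarrow> real"
  assumes "(f has_integral A) {0<..<1}" and "(f has_integral B) {1<..}"
  shows "(f has_integral (A + B)) {0<..}"
proof -
  have "(f has_integral (A + B)) ({0<..<1} \<union> {1<..})"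
    by (rule has_integral_Un[OF assms], rule negligible_subset[of "{1}"]) auto
  moreover have "{0<..<1} \<union> {1<..} = {0<..} - {1::real}"
    by auto
  ultimately show ?thesis
    by (subst has_integral_spike_set_eq[of _ "{0<..} - {1}"])
      (auto intro: negligible_subset[of "{1::real}"])
qed

text \<open>The nonnegative case applies to \<open>- f\<close> on (0,1) and to \<open>f\<close>
  beyond 1. Continuity of \<open>F\<close> at 1 supplies both inner limits, and the two values
  \<open>F 1\<close> cancel.\<close>

lemma has_integral_FTC_halfline_sign_change:
  fixes f F :: "real \<Rightarrow> real"
  assumes F: "\<And>x. 0 < x \<Longrightarrow> (F has_real_derivative f x) (at x)"
    and f: "\<And>x. 0 < x \<Longrightarrow> isCont f x"
    and neg: "\<And>x. 0 < x \<Longrightarrow> x < 1 \<Longrightarrow> f x \<le> 0"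
    and pos: "\<And>x. 1 < x \<Longrightarrow> 0 \<le> f x"
    and A: "(F \<longlongrightarrow> A) (at_right 0)" and B: "(F \<longlongrightarrow> B) at_top"
  shows "(f has_integral (B - A)) {0<..}"
proof -
  have "isCont F 1"
    using F[of 1] by (intro DERIV_isCont) auto
  then have lim: "(F \<longlongrightarrow> F 1) (at_left 1)" "(F \<longlongrightarrow> F 1) (at_right 1)"
    by (auto simp: isCont_def filterlim_at_split)
  have "((\<lambda>x. - f x) has_integral (- F 1 - (- A))) {0<..<1}"
    by (rule has_integral_FTC_nonneg_unit[where F = "\<lambda>x. - F x"])
      (use F f neg A lim in \<open>auto intro!: derivative_eq_intros tendsto_intros\<close>)
  then have "(f has_integral (F 1 - A)) {0<..<1}"
    by (auto dest: has_integral_neg)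
  moreover have "(f has_integral (B - F 1)) {1<..}"
    by (rule has_integral_FTC_nonneg_above_1[where F = F]) (use F f pos B lim in auto)
  ultimately show ?thesis
    by (auto dest: has_integral_halfline_split_1)
qed

section \<open>The integral of ln x / (x^2 - 1)\<close>

text \<open>Integration by parts gives the antiderivative. It is written with the factor
  \<open>x * ln x\<close> split off, so that its limit at 0 follows from x ln x -> 0 even for
  \<open>k = 0\<close>.\<close>

lemma has_integral_power_ln_unit:
  "((\<lambda>x::real. - (x ^ k * ln x)) has_integral (1 / (real k + 1)\<^sup>2)) {0<..<1}"
proof -
  have "((\<lambda>x::real. - (x ^ k * ln x)) has_integral (1 / (real k + 1)\<^sup>2 - 0)) {0<..<1}"
  proof (rule has_integral_FTC_nonneg_unit[where
        F = "\<lambda>x. x ^ (k+1) / (real k + 1)\<^sup>2 - x ^ k * (x * ln x) / (real k + 1)"])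
    fix x :: real assume x: "0 < x" "x < 1"
    show "((\<lambda>x. x ^ (k+1) / (real k + 1)\<^sup>2 - x ^ k * (x * ln x) / (real k + 1))
            has_real_derivative - (x ^ k * ln x)) (at x)"
    proof -
      have "((\<lambda>x. x ^ (k+1) / (real k + 1)\<^sup>2 - x ^ (k + 1) * ln x / (real k + 1))
            has_real_derivative - (x ^ k * ln x)) (at x)"
        using x by (auto intro!: derivative_eq_intros simp del: power_Suc simp: divide_simps)
           (simp add: algebra_simps power2_eq_square)
      then show ?thesis by (simp add: mult_ac)
    qed
    show "isCont (\<lambda>x. - (x ^ k * ln x)) x" using x by (auto intro!: continuous_intros)
    show "0 \<le> - (x ^ k * ln x)" using x by (simp add: mult_nonneg_nonpos)
  next
    have "((\<lambda>x::real. x * ln x) \<longlongrightarrow> 0) (at_right 0)" by real_asymp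
    then have "((\<lambda>x::real. x ^ (k+1) / (real k + 1)\<^sup>2 - x ^ k * (x * ln x) / (real k + 1)) \<longlongrightarrow>
        0 ^ (k+1) / (real k + 1)\<^sup>2 - 0 ^ k * 0 / (real k + 1)) (at_right 0)"
      by (intro tendsto_intros) auto
    then show "((\<lambda>x::real. x ^ (k+1) / (real k + 1)\<^sup>2 - x ^ k * (x * ln x) / (real k + 1)) \<longlongrightarrow> 0) (at_right 0)"
      by simp
    show "((\<lambda>x::real. x ^ (k+1) / (real k + 1)\<^sup>2 - x ^ k * (x * ln x) / (real k + 1)) \<longlongrightarrow> 1 / (real k + 1)\<^sup>2) (at_left 1)"
      by (auto intro!: tendsto_eq_intros)
  qed
  then show ?thesis by simp
qed

text \<open>The mirror image of the previous integral under x -> 1/x, hence the same value. Here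
  \<open>ln x / x\<close> is split off for the limit at infinity.\<close>

lemma has_integral_inverse_power_ln_above_1:
  "((\<lambda>x::real. ln x / x ^ (k + 2)) has_integral (1 / (real k + 1)\<^sup>2)) {1<..}"
proof -
  have "((\<lambda>x::real. ln x / x ^ (k + 2)) has_integral (0 - (- 1 / (real k + 1)\<^sup>2))) {1<..}"
  proof (rule has_integral_FTC_nonneg_above_1[where
        F = "\<lambda>x. - (inverse x ^ k * (ln x / x) / (real k + 1)) - inverse x ^ (k + 1) / (real k + 1)\<^sup>2"])
    fix x :: real assume x: "1 < x"
    show "((\<lambda>x. - (inverse x ^ k * (ln x / x) / (real k + 1)) - inverse x ^ (k + 1) / (real k + 1)\<^sup>2)
            has_real_derivative ln x / x ^ (k + 2)) (at x)"
    proof -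
      have "((\<lambda>x. - (ln x * inverse x ^ (k+1) / (real k + 1)) - inverse x ^ (k + 1) / (real k + 1)\<^sup>2)
            has_real_derivative ln x / x ^ (k + 2)) (at x)"
      proof -
        define N where "N = real k + 1"
        have N: "N > 0" "real (Suc k) = N" by (simp_all add: N_def)
        show ?thesis
          unfolding N_def[symmetric]
          by (rule derivative_eq_intros refl | use x N in force)+
            (use x N(1) in \<open>simp add: N(2) field_simps power2_eq_square del: of_nat_add of_nat_Suc\<close>)
      qed
      then show ?thesis by (simp add: divide_inverse mult_ac)
    qed
    show "isCont (\<lambda>x. ln x / x ^ (k + 2)) x" using x by (auto intro!: continuous_intros)
    show "0 \<le> ln x / x ^ (k + 2)" using x by simp
  next
    have "((\<lambda>x::real. ln x / x) \<longlongrightarrow> 0) at_top" "((\<lambda>x::real. inverse x) \<longlongrightarrow> 0) at_top"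
      by real_asymp+
    then have "((\<lambda>x::real. - (inverse x ^ k * (ln x / x) / (real k + 1)) - inverse x ^ (k + 1) / (real k + 1)\<^sup>2) \<longlongrightarrow> - (0 ^ k * 0 / (real k + 1)) - 0 ^ (k+1) / (real k + 1)\<^sup>2) at_top"
      by (intro tendsto_intros) auto
    then show "((\<lambda>x::real. - (inverse x ^ k * (ln x / x) / (real k + 1)) - inverse x ^ (k + 1) / (real k + 1)\<^sup>2) \<longlongrightarrow> 0) at_top"
      by simp
    show "((\<lambda>x::real. - (inverse x ^ k * (ln x / x) / (real k + 1)) - inverse x ^ (k + 1) / (real k + 1)\<^sup>2) \<longlongrightarrow> - 1 / (real k + 1)\<^sup>2) (at_right 1)"
      by (auto intro!: tendsto_eq_intros)
  qed
  then show ?thesis by simp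
qed

text \<open>In the Basel series the terms with even denominators add up to a quarter of the total,
  which leaves (3/4) (pi^2/6) for the odd ones.\<close>

lemma inverse_odd_squares_sums: "(\<lambda>n. 1 / (real (2 * n) + 1)\<^sup>2) sums (pi\<^sup>2 / 8)"
proof -
  let ?f = "\<lambda>n. 1 / (real n + 1)\<^sup>2"
  have f: "?f sums (pi\<^sup>2 / 6)"
    using inverse_squares_sums by (simp add: add.commute)
  have "(\<lambda>n. \<Sum>i\<in>{n*2..<n*2+2}. ?f i) sums (pi\<^sup>2 / 6)"
    by (rule sums_group[OF f]) auto
  moreover have "(\<Sum>i\<in>{n*2..<n*2+2}. ?f i) = 1 / (real (2 * n) + 1)\<^sup>2 + ?f n / 4" for n
  proof -
    have "{n*2..<n*2+2} = {2*n, 2*n+1}" by auto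
    moreover have "?f (2*n+1) = ?f n / 4" by (simp add: field_simps power2_eq_square)
    ultimately show ?thesis by simp
  qed
  ultimately have "(\<lambda>n. 1 / (real (2 * n) + 1)\<^sup>2 + ?f n / 4) sums (pi\<^sup>2 / 6)" by simp
  from sums_diff[OF this sums_divide[OF f, of 4]] show ?thesis
    by (simp add: field_simps)
qed

text \<open>Expand in powers of x^2 on (0,1) and of 1/x^2 beyond 1. All terms are nonnegative, so
  monotone convergence allows termwise integration, and each half contributes pi^2/8.\<close>

lemma has_integral_ln_over_square_minus_1:
  "((\<lambda>x::real. ln x / (x\<^sup>2 - 1)) has_integral (pi\<^sup>2 / 4)) {0<..}"
proof -
  have lim: "(\<lambda>n. \<Sum>i<n. 1 / (real (2 * i) + 1)\<^sup>2) \<longlonglongrightarrow> pi\<^sup>2 / 8"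
    using inverse_odd_squares_sums by (simp add: sums_def)
  have "((\<lambda>x::real. ln x / (x\<^sup>2 - 1)) has_integral (pi\<^sup>2 / 8)) {0<..<1}"
  proof (rule has_integral_monotone_convergence_increasing[OF _ _ _ lim])
    show "((\<lambda>x. \<Sum>i<n. - (x ^ (2*i) * ln x)) has_integral (\<Sum>i<n. 1 / (real (2 * i) + 1)\<^sup>2)) {0<..<1}" for n
      by (intro has_integral_sum has_integral_power_ln_unit) auto
  next
    fix n and x :: real assume "x \<in> {0<..<1}"
    then show "(\<Sum>i<n. - (x ^ (2*i) * ln x)) \<le> (\<Sum>i<Suc n. - (x ^ (2*i) * ln x))"
      by (simp add: mult_nonneg_nonpos)
  next
    fix x :: real assume x: "x \<in> {0<..<1}"
    then have "\<bar>x\<^sup>2\<bar> < 1" by (simp add: abs_square_less_1)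
    then have "(\<lambda>n. (x\<^sup>2) ^ n) sums (1 / (1 - x\<^sup>2))" by (intro geometric_sums) simp
    from sums_mult[OF this, of "- ln x"]
    have "(\<lambda>n. - (x ^ (2*n) * ln x)) sums (- ln x * (1 / (1 - x\<^sup>2)))"
      by (simp add: power_mult mult_ac flip: power_mult)
    also have "- ln x * (1 / (1 - x\<^sup>2)) = ln x / (x\<^sup>2 - 1)"
      using \<open>\<bar>x\<^sup>2\<bar> < 1\<close> by (simp add: divide_simps) (simp add: algebra_simps)
    finally show "(\<lambda>n. \<Sum>i<n. - (x ^ (2*i) * ln x)) \<longlonglongrightarrow> ln x / (x\<^sup>2 - 1)"
      by (simp add: sums_def)
  qed
  moreover have "((\<lambda>x::real. ln x / (x\<^sup>2 - 1)) has_integral (pi\<^sup>2 / 8)) {1<..}"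
  proof (rule has_integral_monotone_convergence_increasing[OF _ _ _ lim])
    show "((\<lambda>x. \<Sum>i<n. ln x / x ^ (2*i+2)) has_integral (\<Sum>i<n. 1 / (real (2 * i) + 1)\<^sup>2)) {1<..}" for n
      by (intro has_integral_sum has_integral_inverse_power_ln_above_1) auto
  next
    fix n and x :: real assume "x \<in> {1<..}"
    then show "(\<Sum>i<n. ln x / x ^ (2*i+2)) \<le> (\<Sum>i<Suc n. ln x / x ^ (2*i+2))"
      by simp
  next
    fix x :: real assume x: "x \<in> {1<..}"
    then have "1 < x\<^sup>2" by simp
    then have "\<bar>1 / x\<^sup>2\<bar> < 1" by (simp add: divide_simps)
    then have "(\<lambda>n. (1 / x\<^sup>2) ^ n) sums (1 / (1 - 1 / x\<^sup>2))" by (intro geometric_sums) simp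
    from sums_mult[OF this, of "ln x / x\<^sup>2"]
    have "(\<lambda>n. ln x / x\<^sup>2 * (1 / x\<^sup>2) ^ n) sums (ln x / x\<^sup>2 * (1 / (1 - 1 / x\<^sup>2)))" .
    also have "(\<lambda>n. ln x / x\<^sup>2 * (1 / x\<^sup>2) ^ n) = (\<lambda>n. ln x / x ^ (2*n+2))"
      by (simp add: power_divide power2_eq_square[symmetric] mult_ac flip: power_mult power_add)
    also have "ln x / x\<^sup>2 * (1 / (1 - 1 / x\<^sup>2)) = ln x / (x\<^sup>2 - 1)"
      using x \<open>1 < x\<^sup>2\<close> by (simp add: field_simps)
    finally show "(\<lambda>n. \<Sum>i<n. ln x / x ^ (2*i+2)) \<longlonglongrightarrow> ln x / (x\<^sup>2 - 1)"
      by (simp add: sums_def)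
  qed
  ultimately show ?thesis
    by (auto dest: has_integral_halfline_split_1)
qed

section \<open>The integral of ln x (1/(x + 1) - 1/(x + a))\<close>

lemma ex_antiderivative_halfline:
  fixes p :: "real \<Rightarrow> real"
  assumes "continuous_on {0<..} p"
  shows "\<exists>P. \<forall>x>0. (P has_real_derivative p x) (at x)"
proof (intro exI allI impI)
  fix x :: real assume x: "0 < x"
  \<comment> \<open>The interval [a,b] lies in the positive reals and contains both the base point 1
    and, in its interior, \<open>x\<close>.\<close>
  define a b where "a = min (x/2) (1/2)" and "b = max (x+1) 2"
  have ab: "0 < a" "a \<le> 1" "1 \<le> b" "a < x" "x < b" using x by (auto simp: a_def b_def)
  have "((\<lambda>u. LBINT y=1..u. p y) has_vector_derivative p x) (at x within {a..b})"
    using interval_integral_FTC2[of a 1 b p x] continuous_on_subset[OF assms, of "{a..b}"] ab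
    by (auto simp: subset_eq one_ereal_def)
  then show "((\<lambda>u. LBINT y=1..u. p y) has_real_derivative p x) (at x)"
    using ab by (simp add: at_within_Icc_at has_real_derivative_iff_has_vector_derivative)
qed

text \<open>The mean value theorem in the variable \<open>ln x\<close>.\<close>
lemma scaled_difference_mvt:
  fixes P p :: "real \<Rightarrow> real"
  assumes P: "\<And>x. 0 < x \<Longrightarrow> (P has_real_derivative p x) (at x)" and "0 < c" "0 < x"
  shows "\<exists>\<xi>. min 1 (1/c) * x \<le> \<xi> \<and> \<xi> \<le> max 1 (1/c) * x \<and> \<bar>P x - P (x/c)\<bar> = \<bar>ln c\<bar> * \<bar>\<xi> * p \<xi>\<bar>"
proof -
  \<comment> \<open>After substituting x = exp s, the points x and x/c are ln c apart, and the
    derivative of P(exp s) is \<xi> p(\<xi>) at \<xi> = exp s.\<close>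
  let ?Q = "\<lambda>s. P (exp s)" and ?q = "\<lambda>s. exp s * p (exp s)"
  have Q: "(?Q has_real_derivative ?q s) (at s)" for s
    by (rule DERIV_cong[OF DERIV_chain2[OF P]]) (auto intro!: derivative_eq_intros)
  consider "c = 1" | "1 < c" | "c < 1" by linarith
  then show ?thesis
  proof cases
    case 1
    then show ?thesis by (intro exI[of _ x]) auto
  next
    case 2
    then have lt: "ln (x/c) < ln x" using assms by (simp add: divide_less_eq)
    obtain z where z: "ln (x/c) < z" "z < ln x" "?Q (ln x) - ?Q (ln (x/c)) = (ln x - ln (x/c)) * ?q z"
      using MVT2[OF lt Q] by auto
    have "x/c < exp z" "exp z < x"
      using z(1,2) assms by (metis divide_pos_pos exp_less_cancel_iff exp_ln)+
    moreover have "P x - P (x/c) = ln c * ?q z"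
      using z(3) assms by (simp add: ln_div exp_diff algebra_simps)
    ultimately show ?thesis
      using assms 2 by (intro exI[of _ "exp z"]) (auto simp: ln_div abs_mult min_def max_def)
  next
    case 3
    then have lt: "ln x < ln (x/c)" using assms by (simp add: less_divide_eq)
    obtain z where z: "ln x < z" "z < ln (x/c)" "?Q (ln (x/c)) - ?Q (ln x) = (ln (x/c) - ln x) * ?q z"
      using MVT2[OF lt Q] by auto
    have "exp z < x/c" "x < exp z"
      using z(1,2) assms by (metis divide_pos_pos exp_less_cancel_iff exp_ln)+
    moreover have "P x - P (x/c) = ln c * ?q z"
      using z(3) assms by (simp add: ln_div exp_diff algebra_simps)
    ultimately show ?thesis
      using 3 assms by (intro exI[of _ "exp z"]) (auto simp: abs_mult min_def max_def)
  qed
qed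

text \<open>The intermediate point \<xi> is squeezed between constant multiples of x, so it
  approaches the same endpoint as x. The factor ln c is fixed, hence x p(x) -> 0 suffices.\<close>

lemma scaled_difference_tendsto_0:
  fixes P p :: "real \<Rightarrow> real"
  assumes P: "\<And>x. 0 < x \<Longrightarrow> (P has_real_derivative p x) (at x)" and c: "0 < c"
  shows "((\<lambda>x. x * p x) \<longlongrightarrow> 0) (at_right 0) \<Longrightarrow> ((\<lambda>x. P x - P (x/c)) \<longlongrightarrow> 0) (at_right 0)" (is "?L1 \<Longrightarrow> _")
    and "((\<lambda>x. x * p x) \<longlongrightarrow> 0) at_top \<Longrightarrow> ((\<lambda>x. P x - P (x/c)) \<longlongrightarrow> 0) at_top" (is "?L2 \<Longrightarrow> _")
proof -
  let ?k = "min 1 (1/c)" and ?K = "max 1 (1/c)"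
  have "\<forall>x. \<exists>\<xi>. 0 < x \<longrightarrow> ?k * x \<le> \<xi> \<and> \<xi> \<le> ?K * x \<and> \<bar>P x - P (x/c)\<bar> = \<bar>ln c\<bar> * \<bar>\<xi> * p \<xi>\<bar>"
    using scaled_difference_mvt[OF P c] by blast
  then obtain \<xi> where \<xi>: "\<And>x. 0 < x \<Longrightarrow> ?k * x \<le> \<xi> x" "\<And>x. 0 < x \<Longrightarrow> \<xi> x \<le> ?K * x"
    "\<And>x. 0 < x \<Longrightarrow> \<bar>P x - P (x/c)\<bar> = \<bar>ln c\<bar> * \<bar>\<xi> x * p (\<xi> x)\<bar>"
    by metis
  have k: "0 < ?k" using c by simp
  have lim: "((\<lambda>x. P x - P (x/c)) \<longlongrightarrow> 0) F"
    if "((\<lambda>x. x * p x) \<longlongrightarrow> 0) F" "filterlim \<xi> F F" "eventually (\<lambda>x. 0 < x) F" for F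
  proof -
    have "((\<lambda>x. \<xi> x * p (\<xi> x)) \<longlongrightarrow> 0) F"
      using filterlim_compose[OF that(1,2)] .
    then have "((\<lambda>x. \<bar>ln c\<bar> * \<bar>\<xi> x * p (\<xi> x)\<bar>) \<longlongrightarrow> 0) F"
      by (intro tendsto_mult_right_zero tendsto_rabs_zero)
    then have "((\<lambda>x. \<bar>P x - P (x/c)\<bar>) \<longlongrightarrow> 0) F"
      by (rule Lim_transform_eventually) (use that(3) \<xi>(3) in \<open>auto elim!: eventually_mono\<close>)
    then show ?thesis by (rule tendsto_rabs_zero_cancel)
  qed
  have pos0: "eventually (\<lambda>x::real. 0 < x) (at_right 0)"
    by (simp add: eventually_at_right_less)
  have "filterlim \<xi> (at_right 0) (at_right 0)"
  proof (rule tendsto_imp_filterlim_at_right)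
    show "(\<xi> \<longlongrightarrow> 0) (at_right 0)"
    proof (rule tendsto_sandwich)
      show "eventually (\<lambda>x. ?k * x \<le> \<xi> x) (at_right 0)" "eventually (\<lambda>x. \<xi> x \<le> ?K * x) (at_right 0)"
        using pos0 \<xi> by (auto elim!: eventually_mono)
    qed (auto intro!: tendsto_eq_intros)
    show "eventually (\<lambda>x. 0 < \<xi> x) (at_right 0)"
      using pos0 by (rule eventually_mono) (use \<xi>(1) k in \<open>meson less_le_trans mult_pos_pos\<close>)
  qed
  then show "?L1 \<Longrightarrow> ((\<lambda>x. P x - P (x/c)) \<longlongrightarrow> 0) (at_right 0)"
    using lim pos0 by blast
  have "filterlim \<xi> at_top at_top"
  proof (rule filterlim_at_top_mono)
    show "filterlim (\<lambda>x. ?k * x) at_top at_top"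
      using k by (intro filterlim_tendsto_pos_mult_at_top[OF tendsto_const] filterlim_ident)
    show "eventually (\<lambda>x. ?k * x \<le> \<xi> x) at_top"
      using eventually_gt_at_top[of 0] by (rule eventually_mono) (use \<xi> in auto)
  qed
  then show "?L2 \<Longrightarrow> ((\<lambda>x. P x - P (x/c)) \<longlongrightarrow> 0) at_top"
    using lim eventually_gt_at_top[of 0] by blast
qed

lemma has_integral_ln_partial_fractions:
  fixes a :: real
  assumes a: "0 < a"
  shows "((\<lambda>x. ln x * (1 / (x + 1) - 1 / (x + a))) has_integral ((ln a)\<^sup>2 / 2)) {0<..}"
proof -
  let ?f = "\<lambda>x. ln x * (1 / (x + 1) - 1 / (x + a))"
  have "continuous_on {0<..} (\<lambda>x::real. ln x / (x + 1))"
    by (auto intro!: continuous_intros)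
  then obtain P where P: "\<And>x::real. 0 < x \<Longrightarrow> (P has_real_derivative ln x / (x + 1)) (at x)"
    using ex_antiderivative_halfline by blast
  \<comment> \<open>The derivative of P(x/a) is (ln x - ln a)/(x + a); the last term of
    \<open>F\<close> compensates for the part with ln a.\<close>
  define F where "F = (\<lambda>x. P x - P (x/a) - ln a * ln (x + a))"
  have F: "(F has_real_derivative ?f x) (at x)" if x: "0 < x" for x
  proof -
    have "((\<lambda>x. P (x/a)) has_real_derivative ln (x/a) / (x/a + 1) * (1/a)) (at x)"
      by (rule DERIV_chain2[OF P]) (use x a in \<open>auto intro!: derivative_eq_intros\<close>)
    then have "(F has_real_derivative (ln x / (x + 1) - ln (x/a) / (x/a + 1) * (1/a) - ln a * (1 / (x + a)))) (at x)"
      unfolding F_def using x a by (auto intro!: derivative_eq_intros P)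
    moreover have "ln (x/a) / (x/a + 1) * (1/a) = (ln x - ln a) / (x + a)"
    proof -
      have "x/a + 1 = (x + a) / a" using a by (simp add: field_simps)
      then show ?thesis using x a by (simp add: ln_div)
    qed
    ultimately show ?thesis by (simp add: algebra_simps diff_divide_distrib)
  qed
  have A: "(F \<longlongrightarrow> - (ln a)\<^sup>2) (at_right 0)"
  proof -
    have "((\<lambda>x::real. x * (ln x / (x + 1))) \<longlongrightarrow> 0) (at_right 0)" by real_asymp
    then have "((\<lambda>x. P x - P (x/a)) \<longlongrightarrow> 0) (at_right 0)"
      by (rule scaled_difference_tendsto_0(1)[where p = "\<lambda>x. ln x / (x + 1)", OF P a, rotated])
    then have "(F \<longlongrightarrow> 0 - ln a * ln (0 + a)) (at_right 0)"
      unfolding F_def using a by (intro tendsto_intros) auto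
    then show ?thesis by (simp add: power2_eq_square)
  qed
  have B: "(F \<longlongrightarrow> - (ln a)\<^sup>2 / 2) at_top"
  proof -
    \<comment> \<open>At infinity x ln x/(x + 1) is unbounded, so \<open>P\<close> itself does not
      qualify. Subtracting (ln x)^2/2 leaves the derivative -ln x/(x (x + 1)), which decays fast
      enough.\<close>
    let ?R = "\<lambda>x. P x - (ln x)\<^sup>2 / 2"
    have R: "(?R has_real_derivative (ln x / (x + 1) - ln x / x)) (at x)" if "0 < x" for x
      using that by (auto intro!: derivative_eq_intros P)
    have "((\<lambda>x::real. x * (ln x / (x + 1) - ln x / x)) \<longlongrightarrow> 0) at_top" by real_asymp
    then have "((\<lambda>x. ?R x - ?R (x/a)) \<longlongrightarrow> 0) at_top"
      by (rule scaled_difference_tendsto_0(2)[where p = "\<lambda>x. ln x / (x + 1) - ln x / x", OF R a, rotated])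
    moreover have "((\<lambda>x. ln x - ln (x + a)) \<longlongrightarrow> 0) at_top" using a by real_asymp
    \<comment> \<open>Restoring the subtracted squares uses (ln x)^2/2 - (ln (x/a))^2/2 = ln a ln x
      - (ln a)^2/2.\<close>
    ultimately have "((\<lambda>x. (?R x - ?R (x/a)) + (ln a * (ln x - ln (x + a)) - (ln a)\<^sup>2 / 2)) \<longlongrightarrow> 0 + (ln a * 0 - (ln a)\<^sup>2 / 2)) at_top"
      by (intro tendsto_intros) auto
    then have "((\<lambda>x. (?R x - ?R (x/a)) + (ln a * (ln x - ln (x + a)) - (ln a)\<^sup>2 / 2)) \<longlongrightarrow> - (ln a)\<^sup>2 / 2) at_top"
      by simp
    then show ?thesis
    proof (rule Lim_transform_eventually)
      show "\<forall>\<^sub>F x in at_top. (?R x - ?R (x/a)) + (ln a * (ln x - ln (x + a)) - (ln a)\<^sup>2 / 2) = F x"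
        using eventually_gt_at_top[of 0]
        by (rule eventually_mono) (use a in \<open>simp add: F_def ln_div power2_eq_square field_simps\<close>)
    qed
  qed
  have cont: "isCont ?f x" if "0 < x" for x
    using that a by (auto intro!: continuous_intros)
  show ?thesis
  \<comment> \<open>For a at least 1 the bracket is nonnegative and the integrand has the sign of ln
    x; for smaller a every sign flips, so the negated integrand is used.\<close>
  proof (cases "1 \<le> a")
    case True
    have "(?f has_integral (- (ln a)\<^sup>2 / 2 - (- (ln a)\<^sup>2))) {0<..}"
    proof (rule has_integral_FTC_halfline_sign_change[OF F cont _ _ A B])
      fix x :: real assume "0 < x" "x < 1"
      then show "?f x \<le> 0" using a True by (intro mult_nonpos_nonneg) (auto simp: frac_le)
    next
      fix x :: real assume "1 < x"
      then show "0 \<le> ?f x" using a True by (intro mult_nonneg_nonneg) (auto simp: frac_le)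
    qed
    then show ?thesis by (simp add: field_simps)
  next
    case False
    have "((\<lambda>x. - ?f x) has_integral (- (- (ln a)\<^sup>2 / 2) - (- (- (ln a)\<^sup>2)))) {0<..}"
    proof (rule has_integral_FTC_halfline_sign_change[where F = "\<lambda>x. - F x"])
      fix x :: real assume "0 < x" "x < 1"
      then have "0 \<le> ?f x" using a False by (intro mult_nonpos_nonpos) (auto simp: frac_le)
      then show "- ?f x \<le> 0" by simp
    next
      fix x :: real assume "1 < x"
      then have "?f x \<le> 0" using a False by (intro mult_nonneg_nonpos) (auto simp: frac_le)
      then show "0 \<le> - ?f x" by simp
    qed (intro tendsto_minus A B DERIV_minus F continuous_minus cont; assumption)+
    from has_integral_neg[OF this] show ?thesis by (simp add: field_simps)
  qed
qed

section \<open>The kernel integrals and their recurrence\<close>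

text \<open>Partial fractions: (1 + a)/((x - 1)(x + a)) = 1/(x - 1) - 1/(x + a), and 1/(x - 1) =
  2/(x^2 - 1) + 1/(x + 1).\<close>

lemma has_integral_ln_kernel_0:
  fixes a :: real
  assumes a: "0 < a"
  shows "((\<lambda>x. ln x / ((x - 1) * (x + a))) has_integral ((pi\<^sup>2 + (ln a)\<^sup>2) / (2 * (1 + a)))) {0<..}"
proof -
  have "((\<lambda>x. (2 * (ln x / (x\<^sup>2 - 1)) + ln x * (1 / (x + 1) - 1 / (x + a))) / (1 + a))
      has_integral ((2 * (pi\<^sup>2 / 4) + (ln a)\<^sup>2 / 2) / (1 + a))) {0<..}"
    by (intro has_integral_divide has_integral_add has_integral_mult_right
        has_integral_ln_over_square_minus_1 has_integral_ln_partial_fractions a)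
  also have "(2 * (pi\<^sup>2 / 4) + (ln a)\<^sup>2 / 2) / (1 + a) = (pi\<^sup>2 + (ln a)\<^sup>2) / (2 * (1 + a))"
    using a by (simp add: field_simps)
  finally show ?thesis
  proof (rule has_integral_eq[rotated])
    fix x :: real assume "x \<in> {0<..}"
    then have x: "0 < x" by simp
    show "(2 * (ln x / (x\<^sup>2 - 1)) + ln x * (1 / (x + 1) - 1 / (x + a))) / (1 + a) = ln x / ((x - 1) * (x + a))"
    proof (cases "x = 1")
      case False
      have "(2 * (1 / (x\<^sup>2 - 1)) + (1 / (x + 1) - 1 / (x + a))) / (1 + a) = 1 / ((x - 1) * (x + a))"
      proof -
        have "x\<^sup>2 - 1 = (x - 1) * (x + 1)" by (simp add: power2_eq_square algebra_simps)
        moreover have "x - 1 \<noteq> 0" "x + 1 \<noteq> 0" "x + a \<noteq> 0" "1 + a \<noteq> 0" using False x a by auto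
        ultimately show ?thesis by (simp add: divide_simps) (simp add: algebra_simps)
      qed
      from arg_cong[OF this, of "\<lambda>y. ln x * y"] show ?thesis
        by (simp add: algebra_simps add_divide_distrib diff_divide_distrib)
    \<comment> \<open>At x = 1 both sides are 0, because ln 1 = 0 and division by zero yields
      0.\<close>
    qed simp
  qed
qed

text \<open>With u = x/(x + a) the integrand is u^n u' ln x. Integration by parts leaves u^n/(x +
  a), and 1/(x + a) minus this is a geometric sum of the u^k u'. Integrating that sum produces the
  harmonic number at u = 1; the lower limit contributes ln a.\<close>

lemma has_integral_ln_beta_kernel:
  fixes a :: real
  assumes a: "0 < a"
  shows "((\<lambda>x. ln x * (a * x ^ n / (x + a) ^ (n + 2))) has_integral ((ln a + harm n) / (real n + 1))) {0<..}"
proof -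
  define u where "u = (\<lambda>x. x / (x + a))"
  define F where "F = (\<lambda>x. (u x ^ Suc n * ln x - ln (x + a) + (\<Sum>k<n. u x ^ Suc k / (real k + 1))) / (real n + 1))"
  have u0: "(u \<longlongrightarrow> 0) (at_right 0)" and u1: "(u \<longlongrightarrow> 1) at_top"
    unfolding u_def using a by real_asymp+
  have harm: "harm n = (\<Sum>k<n. 1 ^ Suc k / (real k + 1))"
    by (induction n) (simp_all add: harm_Suc harm_expand field_simps)
  have "((\<lambda>x. ln x * (a * x ^ n / (x + a) ^ (n + 2))) has_integral (harm n / (real n + 1) - (- ln a / (real n + 1)))) {0<..}"
  proof (rule has_integral_FTC_halfline_sign_change[where F = F])
    fix x :: real assume x: "0 < x"
    have ux: "(u has_real_derivative a / (x + a)\<^sup>2) (at x)"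
      unfolding u_def using x a
      by (auto intro!: derivative_eq_intros simp: power2_eq_square field_simps)
    have pw: "((\<lambda>x. u x ^ Suc k / (real k + 1)) has_real_derivative u x ^ k * (a / (x + a)\<^sup>2)) (at x)" for k
    proof -
      have "1 + real k \<noteq> 0" by linarith
      then show ?thesis
        by (intro DERIV_cong[OF DERIV_cdivide[OF DERIV_power_Suc[OF ux]]]) (simp add: mult_ac add.commute)
    qed
    have main: "((\<lambda>x. u x ^ Suc n * ln x) has_real_derivative
        (real n + 1) * (u x ^ n * (a / (x + a)\<^sup>2)) * ln x + u x ^ Suc n / x) (at x)"
      by (rule derivative_eq_intros ux refl | use x in force)+
    have ln: "((\<lambda>x. ln (x + a)) has_real_derivative 1 / (x + a)) (at x)"
      using x a by (auto intro!: derivative_eq_intros)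
    have D: "(F has_real_derivative ((real n + 1) * (u x ^ n * (a / (x + a)\<^sup>2)) * ln x + u x ^ Suc n / x - 1 / (x + a)
        + (\<Sum>k<n. u x ^ k * (a / (x + a)\<^sup>2))) / (real n + 1)) (at x)"
      unfolding F_def by (intro DERIV_cdivide DERIV_add DERIV_diff DERIV_sum main pw ln)
    have u: "1 - u x = a / (x + a)" "u x / x = 1 / (x + a)"
      using x a by (simp add: u_def field_simps, simp add: u_def)
    have "(\<Sum>k<n. u x ^ k * (a / (x + a)\<^sup>2)) = (1 - u x) * (\<Sum>k<n. u x ^ k) / (x + a)"
      by (simp add: u(1) sum_distrib_left sum_distrib_right power2_eq_square mult_ac sum_divide_distrib)
    also have "(1 - u x) * (\<Sum>k<n. u x ^ k) = 1 - u x ^ n"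
      by (simp add: one_diff_power_eq)
    finally have S: "(\<Sum>k<n. u x ^ k * (a / (x + a)\<^sup>2)) = (1 - u x ^ n) / (x + a)" .
    have "((real n + 1) * (u x ^ n * (a / (x + a)\<^sup>2)) * ln x + u x ^ Suc n / x - 1 / (x + a)
        + (\<Sum>k<n. u x ^ k * (a / (x + a)\<^sup>2))) / (real n + 1)
      = ((real n + 1) * (u x ^ n * (a / (x + a)\<^sup>2)) * ln x + u x ^ n * (u x / x - 1 / (x + a))) / (real n + 1)"
      unfolding S by (rule arg_cong[of _ _ "\<lambda>y. y / (real n + 1)"]) (simp add: right_diff_distrib diff_divide_distrib)
    also have "\<dots> = u x ^ n * (a / (x + a)\<^sup>2) * ln x" by (simp add: u(2))
    also have "\<dots> = ln x * (a * x ^ n / (x + a) ^ (n + 2))"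
      by (simp add: u_def power_divide power2_eq_square mult_ac)
    finally show "(F has_real_derivative ln x * (a * x ^ n / (x + a) ^ (n + 2))) (at x)"
      using D by simp
    show "isCont (\<lambda>x. ln x * (a * x ^ n / (x + a) ^ (n + 2))) x"
      using x a by (auto intro!: continuous_intros)
  next
    fix x :: real assume "0 < x" "x < 1"
    then show "ln x * (a * x ^ n / (x + a) ^ (n + 2)) \<le> 0" using a by (intro mult_nonpos_nonneg) auto
  next
    fix x :: real assume "1 < x"
    then show "0 \<le> ln x * (a * x ^ n / (x + a) ^ (n + 2))" using a by (intro mult_nonneg_nonneg) auto
  next
    have "((\<lambda>x. u x * ln x) \<longlongrightarrow> 0) (at_right 0)" unfolding u_def using a by real_asymp
    then have "((\<lambda>x. (u x ^ n * (u x * ln x) - ln (x + a) + (\<Sum>k<n. u x ^ Suc k / (real k + 1))) / (real n + 1))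
        \<longlongrightarrow> (0 ^ n * 0 - ln (0 + a) + (\<Sum>k<n. 0 ^ Suc k / (real k + 1))) / (real n + 1)) (at_right 0)"
      using a by (intro tendsto_intros u0) auto
    then show "(F \<longlongrightarrow> - ln a / (real n + 1)) (at_right 0)"
      unfolding F_def by (simp add: mult_ac)
  next
    \<comment> \<open>The terms u^(n+1) ln x and ln (x + a) diverge separately. Their difference is
      rewritten through 1 - u^(n+1) = (1 - u) (1 + u + ... + u^n) and 1 - u = a/(x + a), so that
      each piece converges.\<close>
    have "((\<lambda>x. a / (x + a) * ln x) \<longlongrightarrow> 0) at_top" "((\<lambda>x. ln x - ln (x + a)) \<longlongrightarrow> 0) at_top"
      using a by real_asymp+
    then have "((\<lambda>x. (- ((\<Sum>k<n+1. u x ^ k) * (a / (x + a) * ln x)) + (ln x - ln (x + a)) + (\<Sum>k<n. u x ^ Suc k / (real k + 1))) / (real n + 1))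
        \<longlongrightarrow> (- ((\<Sum>k<n+1. 1 ^ k) * 0) + 0 + (\<Sum>k<n. 1 ^ Suc k / (real k + 1))) / (real n + 1)) at_top"
      by (intro tendsto_intros u1) auto
    also have "(- ((\<Sum>k<n+1. 1 ^ k) * 0) + 0 + (\<Sum>k<n. 1 ^ Suc k / (real k + 1))) / (real n + 1) = harm n / (real n + 1)"
      by (simp add: harm)
    finally show "(F \<longlongrightarrow> harm n / (real n + 1)) at_top"
    proof (rule Lim_transform_eventually)
      show "\<forall>\<^sub>F x in at_top. (- ((\<Sum>k<n+1. u x ^ k) * (a / (x + a) * ln x)) + (ln x - ln (x + a)) + (\<Sum>k<n. u x ^ Suc k / (real k + 1))) / (real n + 1) = F x"
        using eventually_gt_at_top[of 0]
      proof (rule eventually_mono)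
        fix x :: real assume x: "0 < x"
        have "a / (x + a) = 1 - u x" using x a by (simp add: u_def field_simps)
        then have "(\<Sum>k<n+1. u x ^ k) * (a / (x + a) * ln x) = (1 - u x ^ (n + 1)) * ln x"
          using one_diff_power_eq[of "u x" "n+1"] by (simp only: mult_ac)
        then show "(- ((\<Sum>k<n+1. u x ^ k) * (a / (x + a) * ln x)) + (ln x - ln (x + a)) + (\<Sum>k<n. u x ^ Suc k / (real k + 1))) / (real n + 1) = F x"
          unfolding F_def by (simp only: left_diff_distrib mult_1 Suc_eq_plus1) simp
      qed
    qed
  qed
  then show ?thesis by (simp add: add_divide_distrib add.commute)
qed

text \<open>This is the recurrence in m unrolled: each step adds the beta-type integral and divides
  by 1 + a.\<close>

lemma has_integral_ln_kernel:
  fixes a :: real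
  assumes a: "0 < a"
  shows "((\<lambda>x. ln x * (x ^ m / ((x - 1) * (x + a) ^ (m + 1)))) has_integral
    ((pi\<^sup>2 + (ln a)\<^sup>2) / (2 * (1 + a) ^ (m + 1)) + (\<Sum>j<m. (ln a + harm j) / ((real j + 1) * (1 + a) ^ (m - j))))) {0<..}"
proof (induction m)
  case 0
  then show ?case using has_integral_ln_kernel_0[OF a] by simp
next
  case (Suc m)
  let ?I = "(pi\<^sup>2 + (ln a)\<^sup>2) / (2 * (1 + a) ^ (m + 1)) + (\<Sum>j<m. (ln a + harm j) / ((real j + 1) * (1 + a) ^ (m - j)))"
  have "((\<lambda>x. (ln x * (x ^ m / ((x - 1) * (x + a) ^ (m + 1))) + ln x * (a * x ^ m / (x + a) ^ (m + 2))) / (1 + a))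
      has_integral ((?I + (ln a + harm m) / (real m + 1)) / (1 + a))) {0<..}"
    by (intro has_integral_divide has_integral_add Suc has_integral_ln_beta_kernel a)
  also have "(?I + (ln a + harm m) / (real m + 1)) / (1 + a) =
    (pi\<^sup>2 + (ln a)\<^sup>2) / (2 * (1 + a) ^ (Suc m + 1)) + (\<Sum>j<Suc m. (ln a + harm j) / ((real j + 1) * (1 + a) ^ (Suc m - j)))"
  proof -
    \<comment> \<open>The division raises the exponent of 1 + a in every old term; the new term j =
      m enters with exponent 1.\<close>
    have "(\<Sum>j<m. (ln a + harm j) / ((real j + 1) * (1 + a) ^ (Suc m - j))) =
        (\<Sum>j<m. (ln a + harm j) / ((real j + 1) * (1 + a) ^ (m - j))) / (1 + a)"
      unfolding sum_divide_distrib by (intro sum.cong) (auto simp: Suc_diff_le mult_ac)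
    then show ?thesis by (simp add: add_divide_distrib mult_ac)
  qed
  finally show ?case
  proof (rule has_integral_eq[rotated])
    fix x :: real assume "x \<in> {0<..}"
    then have x: "0 < x" by simp
    show "(ln x * (x ^ m / ((x - 1) * (x + a) ^ (m + 1))) + ln x * (a * x ^ m / (x + a) ^ (m + 2))) / (1 + a)
      = ln x * (x ^ Suc m / ((x - 1) * (x + a) ^ (Suc m + 1)))"
    proof (cases "x = 1")
      case False
      define y where "y = x + a"
      have nz: "x - 1 \<noteq> 0" "y \<noteq> 0" "1 + a \<noteq> 0" using False x a by (auto simp: y_def)
      \<comment> \<open>Over the common denominator the numerator gains the factor y + a (x - 1) = x
        (1 + a): this raises the power of x and accounts for the division by 1 + a.\<close>
      have "x ^ m / ((x - 1) * y ^ (m + 1)) + a * x ^ m / y ^ (m + 2) = x ^ m * (y + a * (x - 1)) / ((x - 1) * y ^ (m + 2))"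
        using nz by (simp add: divide_simps) (simp add: algebra_simps)
      also have "y + a * (x - 1) = x * (1 + a)" by (simp add: y_def algebra_simps)
      finally have E: "x ^ m / ((x - 1) * y ^ (m + 1)) + a * x ^ m / y ^ (m + 2) = x ^ m * (x * (1 + a)) / ((x - 1) * y ^ (m + 2))" .
      have "(x ^ m / ((x - 1) * y ^ (m + 1)) + a * x ^ m / y ^ (m + 2)) / (1 + a) = x ^ Suc m / ((x - 1) * y ^ (Suc m + 1))"
        unfolding E using nz by simp
      then show ?thesis unfolding y_def
        by (metis (no_types, lifting) distrib_left times_divide_eq_right)
    qed simp
  qed
qed

section \<open>Linear combinations of the kernels at reciprocal parameters\<close>

text \<open>For \<open>a b = 1\<close> the quadratic factors as \<open>(x + a) (x + b)\<close>, and the binomial theorem makes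
  one of the two factors cancel in each summand.\<close>
lemma binomial_quadratic_quotient:
  fixes a b c d x :: real
  assumes "0 < a" "0 < b" "a * b = 1" "0 < x"
  shows "(\<Sum>j=0..m+1. real ((m+1) choose j) * (c * a ^ j + d * b ^ j) * x ^ (2*m+1-j))
      / ((x - 1) * (x\<^sup>2 + (a + b) * x + 1) ^ (m+1))
    = c * (x ^ m / ((x - 1) * (x + b) ^ (m + 1))) + d * (x ^ m / ((x - 1) * (x + a) ^ (m + 1)))"
proof -
  have binom: "(\<Sum>j=0..m+1. real ((m+1) choose j) * a ^ j * x ^ (2*m+1-j)) = x ^ m * (x + a) ^ (m + 1)" for a :: real
  proof -
    have "x ^ m * (a + x) ^ (m + 1) = (\<Sum>j\<le>m+1. x ^ m * (real ((m+1) choose j) * a ^ j * x ^ (m + 1 - j)))"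
      unfolding binomial_ring sum_distrib_left ..
    also have "\<dots> = (\<Sum>j=0..m+1. real ((m+1) choose j) * a ^ j * x ^ (2*m+1-j))"
    proof (rule sum.cong)
      fix j assume "j \<in> {0..m+1}"
      then have "2*m+1-j = m + (m + 1 - j)" by auto
      then show "x ^ m * (real ((m+1) choose j) * a ^ j * x ^ (m + 1 - j)) = real ((m+1) choose j) * a ^ j * x ^ (2*m+1-j)"
        by (simp only: power_add mult_ac)
    qed auto
    finally show ?thesis by (simp add: add.commute)
  qed
  have "(\<Sum>j=0..m+1. real ((m+1) choose j) * (c * a ^ j + d * b ^ j) * x ^ (2*m+1-j))
      = c * (\<Sum>j=0..m+1. real ((m+1) choose j) * a ^ j * x ^ (2*m+1-j))
      + d * (\<Sum>j=0..m+1. real ((m+1) choose j) * b ^ j * x ^ (2*m+1-j))"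
    unfolding sum_distrib_left sum.distrib[symmetric] by (intro sum.cong) (auto simp: algebra_simps)
  then have num: "(\<Sum>j=0..m+1. real ((m+1) choose j) * (c * a ^ j + d * b ^ j) * x ^ (2*m+1-j))
      = c * (x ^ m * (x + a) ^ (m + 1)) + d * (x ^ m * (x + b) ^ (m + 1))"
    unfolding binom .
  have "x\<^sup>2 + (a + b) * x + 1 = (x + a) * (x + b)"
    using assms(3) by (simp add: power2_eq_square algebra_simps)
  then have den: "(x\<^sup>2 + (a + b) * x + 1) ^ (m + 1) = (x + a) ^ (m + 1) * (x + b) ^ (m + 1)"
    by (simp only: power_mult_distrib)
  \<comment> \<open>Here \<open>y\<close> stands for x - 1 and may be 0; both sides are then 0. The
    coefficient of the \<open>p\<close>-term ends up over \<open>q\<close>, so \<open>c\<close> is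
    paired with the kernel of the reciprocal parameter.\<close>
  have cancel: "(c * (X * p) + d * (X * q)) / (y * (p * q)) = c * (X / (y * q)) + d * (X / (y * p))"
    if "p \<noteq> 0" "q \<noteq> 0" for p q X y :: real
    using that by (cases "y = 0") (simp_all add: field_simps)
  show ?thesis
    unfolding num den by (rule cancel) (use assms in auto)
qed

text \<open>A common form of both integrals, with A for \<alpha>^r and L for L_r. The choice c = d =
  1 gives the Lucas case and c = -d = 1/sqrt 5 the Fibonacci case.\<close>

lemma has_integral_ln_binomial_kernel:
  fixes A l c d :: real
  assumes A: "0 < A" and l: "l = 2 * ln A"
  defines "L \<equiv> A + 1 / A"
  shows "((\<lambda>x. ln x * (\<Sum>j=0..m+1. real ((m+1) choose j) * (c * A ^ (2*j) + d * (1/A) ^ (2*j)) * x ^ (2*m+1-j))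
            / ((x - 1) * (x\<^sup>2 + (A ^ 2 + (1/A) ^ 2) * x + 1) ^ (m+1)))
      has_integral
        ((c * A ^ (m+1) + d * (1/A) ^ (m+1)) / (2 * L ^ (m+1)) * (pi\<^sup>2 + l\<^sup>2)
         + 1 / L ^ m * (\<Sum>j<m. L ^ j / (real j + 1) *
             ((c * A ^ (m-j) + d * (1/A) ^ (m-j)) * harm j - l * (c * A ^ (m-j) - d * (1/A) ^ (m-j)))))) {0<..}"
proof -
  \<comment> \<open>The kernel integral at A^2, rewritten by 1 + A^2 = A L. Passing from A to 1/A
    fixes L and negates l.\<close>
  define K where "K = (\<lambda>A l. (pi\<^sup>2 + l\<^sup>2) / (2 * (A * L) ^ (m + 1)) + (\<Sum>j<m. (l + harm j) / ((real j + 1) * (A * L) ^ (m - j))))"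
  have L: "0 < L" using A by (simp add: L_def add_pos_pos)
  have "ln (A ^ 2) = l" "ln ((1/A) ^ 2) = - l" using A l by (simp_all add: ln_realpow ln_div)
  moreover have "1 + A ^ 2 = A * L" "1 + (1/A) ^ 2 = 1/A * L"
    using A by (simp_all add: L_def power2_eq_square field_simps)
  ultimately have
    I: "((\<lambda>x. ln x * (x ^ m / ((x - 1) * (x + A ^ 2) ^ (m + 1)))) has_integral K A l) {0<..}"
       "((\<lambda>x. ln x * (x ^ m / ((x - 1) * (x + (1/A) ^ 2) ^ (m + 1)))) has_integral K (1/A) (-l)) {0<..}"
    using has_integral_ln_kernel[of "A ^ 2" m] has_integral_ln_kernel[of "(1/A) ^ 2" m] A
    unfolding K_def by simp_all
  have "((\<lambda>x. c * (ln x * (x ^ m / ((x - 1) * (x + (1/A) ^ 2) ^ (m + 1)))) + d * (ln x * (x ^ m / ((x - 1) * (x + A ^ 2) ^ (m + 1)))))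
      has_integral (c * K (1/A) (-l) + d * K A l)) {0<..}"
    by (intro has_integral_add has_integral_mult_right I)
  also have "c * K (1/A) (-l) + d * K A l =
    (c * A ^ (m+1) + d * (1/A) ^ (m+1)) / (2 * L ^ (m+1)) * (pi\<^sup>2 + l\<^sup>2)
         + 1 / L ^ m * (\<Sum>j<m. L ^ j / (real j + 1) *
             ((c * A ^ (m-j) + d * (1/A) ^ (m-j)) * harm j - l * (c * A ^ (m-j) - d * (1/A) ^ (m-j))))"
  proof -
    \<comment> \<open>The value at 1/A carries positive powers of A, so the crosswise pairing
      restores \<open>c\<close> with A^k and \<open>d\<close> with (1/A)^k.\<close>
    have pw: "1 / (A * L) ^ k = (1/A) ^ k / L ^ k" "1 / (1/A * L) ^ k = A ^ k / L ^ k" for k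
      by (simp_all add: power_mult_distrib power_divide)
    have "1 / L ^ m * (\<Sum>j<m. L ^ j / (real j + 1) *
             ((c * A ^ (m-j) + d * (1/A) ^ (m-j)) * harm j - l * (c * A ^ (m-j) - d * (1/A) ^ (m-j))))
        = (\<Sum>j<m. c * ((- l + harm j) / ((real j + 1) * (1/A * L) ^ (m - j))) + d * ((l + harm j) / ((real j + 1) * (A * L) ^ (m - j))))"
      unfolding sum_distrib_left
    proof (rule sum.cong)
      fix j assume "j \<in> {..<m}"
      then have "L ^ m = L ^ j * L ^ (m - j)" by (simp flip: power_add)
      then have Lj: "L ^ j / L ^ m = 1 / L ^ (m - j)" using L by simp
      have "c * ((- l + harm j) / ((real j + 1) * (1/A * L) ^ (m - j))) + d * ((l + harm j) / ((real j + 1) * (A * L) ^ (m - j)))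
        = c * ((- l + harm j) / (real j + 1) * (1 / (1/A * L) ^ (m - j))) + d * ((l + harm j) / (real j + 1) * (1 / (A * L) ^ (m - j)))"
        by simp
      also have "\<dots> = (c * A ^ (m-j) * (harm j - l) + d * (1/A) ^ (m-j) * (harm j + l)) / (real j + 1) * (1 / L ^ (m - j))"
      proof -
        have "c * ((- l + h) / q * (X / K)) + d * ((l + h) / q * (Y / K)) = (c * X * (h - l) + d * Y * (h + l)) / q * (1 / K)"
          for h q X Y K :: real
          by (cases "q = 0"; cases "K = 0") (simp_all add: field_simps)
        then show ?thesis unfolding pw .
      qed
      also have "\<dots> = (c * A ^ (m-j) * (harm j - l) + d * (1/A) ^ (m-j) * (harm j + l)) / (real j + 1) * (L ^ j / L ^ m)"
        unfolding Lj ..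
      also have "\<dots> = 1 / L ^ m * (L ^ j / (real j + 1) *
             ((c * A ^ (m-j) + d * (1/A) ^ (m-j)) * harm j - l * (c * A ^ (m-j) - d * (1/A) ^ (m-j))))"
      proof -
        have "c * X * (h - l) + d * Y * (h + l) = (c * X + d * Y) * h - l * (c * X - d * Y)" for h X Y :: real
          by (simp add: algebra_simps)
        then show ?thesis by (simp only:) (simp only: times_divide_eq_left times_divide_eq_right divide_divide_eq_left mult_1 mult_ac)
      qed
      finally show "1 / L ^ m * (L ^ j / (real j + 1) *
             ((c * A ^ (m-j) + d * (1/A) ^ (m-j)) * harm j - l * (c * A ^ (m-j) - d * (1/A) ^ (m-j))))
        = c * ((- l + harm j) / ((real j + 1) * (1/A * L) ^ (m - j))) + d * ((l + harm j) / ((real j + 1) * (A * L) ^ (m - j)))" ..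
    qed auto
    moreover have "(c * A ^ (m+1) + d * (1/A) ^ (m+1)) / (2 * L ^ (m+1)) * (pi\<^sup>2 + l\<^sup>2)
      = c * ((pi\<^sup>2 + (-l)\<^sup>2) / (2 * (1/A * L) ^ (m + 1))) + d * ((pi\<^sup>2 + l\<^sup>2) / (2 * (A * L) ^ (m + 1)))"
    proof -
      have "c * ((pi\<^sup>2 + (-l)\<^sup>2) / (2 * (1/A * L) ^ (m + 1))) + d * ((pi\<^sup>2 + l\<^sup>2) / (2 * (A * L) ^ (m + 1)))
        = (c * (1 / (1/A * L) ^ (m + 1)) + d * (1 / (A * L) ^ (m + 1))) * ((pi\<^sup>2 + l\<^sup>2) / 2)"
      proof -
        have "c * (z / (2 * p)) + d * (z / (2 * q)) = (c * (1 / p) + d * (1 / q)) * (z / 2)" for z p q :: real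
          by (simp add: distrib_right)
        then show ?thesis unfolding power2_minus .
      qed
      also have "\<dots> = (c * A ^ (m+1) + d * (1/A) ^ (m+1)) / L ^ (m+1) * ((pi\<^sup>2 + l\<^sup>2) / 2)"
        unfolding pw by (simp add: add_divide_distrib)
      finally show ?thesis by simp
    qed
    ultimately show ?thesis
      unfolding K_def sum.distrib sum_distrib_left[symmetric] by (simp only: distrib_left ac_simps)
  qed
  finally show ?thesis
  proof (rule has_integral_eq[rotated])
    fix x :: real assume "x \<in> {0<..}"
    then show "c * (ln x * (x ^ m / ((x - 1) * (x + (1/A) ^ 2) ^ (m + 1)))) + d * (ln x * (x ^ m / ((x - 1) * (x + A ^ 2) ^ (m + 1))))
      = ln x * (\<Sum>j=0..m+1. real ((m+1) choose j) * (c * A ^ (2*j) + d * (1/A) ^ (2*j)) * x ^ (2*m+1-j))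
            / ((x - 1) * (x\<^sup>2 + (A ^ 2 + (1/A) ^ 2) * x + 1) ^ (m+1))"
      using A binomial_quadratic_quotient[of "A ^ 2" "(1/A) ^ 2" x m c d]
      unfolding power_mult times_divide_eq_right[symmetric, of "ln x"]
      by (simp add: power_mult distrib_left mult_ac power_divide)
  qed
qed

section \<open>Binet formulas for integer indices\<close>

lemma int_recurrence_unique:
  fixes f g :: "int \<Rightarrow> 'a :: ab_group_add"
  assumes f: "\<And>n. f (n + 1) = f n + f (n - 1)" and g: "\<And>n. g (n + 1) = g n + g (n - 1)"
    and "f 0 = g 0" "f 1 = g 1"
  shows "f n = g n"
proof -
  \<comment> \<open>Carrying two consecutive values lets the induction run both upwards and
    downwards from 0.\<close>
  have "f n = g n \<and> f (n + 1) = g (n + 1)"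
  proof (induction n rule: int_induct[where k = 0])
    case base
    then show ?case using assms by simp
  next
    case (step1 i)
    then show ?case using f[of "i + 1"] g[of "i + 1"] by simp
  next
    case (step2 i)
    then show ?case using f[of i] g[of i] by (metis add_left_cancel diff_add_cancel)
  qed
  then show ?thesis ..
qed

lemma power_int_recurrence:
  fixes x :: real
  assumes "x\<^sup>2 = x + 1"
  shows "x powi (n + 1) = x powi n + x powi (n - 1)"
proof -
  have x: "x \<noteq> 0" using assms by auto
  have "x powi (n + 1) = x powi (n - 1) * x\<^sup>2"
    using x power_int_add[of x "n - 1" 2] by (simp add: add.commute)
  also have "\<dots> = x powi (n - 1) * x + x powi (n - 1)"
    by (simp add: assms algebra_simps)
  also have "x powi (n - 1) * x = x powi n"
    using x power_int_add[of x "n - 1" 1] by simp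
  finally show ?thesis .
qed

lemma golden_ratio_conjugates_square:
  "golden_ratio\<^sup>2 = golden_ratio + 1" "((1 - sqrt 5) / 2)\<^sup>2 = (1 - sqrt 5) / 2 + 1"
  by (simp_all add: golden_ratio_def power2_eq_square field_simps)

lemma golden_ratio_pos: "0 < golden_ratio"
  by (simp add: golden_ratio_def add_pos_pos)

text \<open>Integer powers of both roots of x^2 = x + 1 satisfy the recurrence, so comparing the
  values at 0 and 1 suffices.\<close>

lemma lucasZ_Binet: "real_of_int (lucasZ n) = golden_ratio powi n + ((1 - sqrt 5) / 2) powi n"
proof (rule int_recurrence_unique)
  show "real_of_int (lucasZ (n + 1)) = real_of_int (lucasZ n) + real_of_int (lucasZ (n - 1))" for n
    by (simp add: lucasZ_rec)
qed (simp_all add: power_int_recurrence golden_ratio_conjugates_square, simp add: golden_ratio_def field_simps)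

lemma fibZ_Binet: "real_of_int (fibZ n) = (golden_ratio powi n - ((1 - sqrt 5) / 2) powi n) / sqrt 5"
proof (rule int_recurrence_unique)
  show "real_of_int (fibZ (n + 1)) = real_of_int (fibZ n) + real_of_int (fibZ (n - 1))" for n
    by (simp add: fibZ_rec)
  show "(golden_ratio powi (n + 1) - ((1 - sqrt 5) / 2) powi (n + 1)) / sqrt 5
    = (golden_ratio powi n - ((1 - sqrt 5) / 2) powi n) / sqrt 5
    + (golden_ratio powi (n - 1) - ((1 - sqrt 5) / 2) powi (n - 1)) / sqrt 5" for n
    unfolding power_int_recurrence[OF golden_ratio_conjugates_square(1)]
      power_int_recurrence[OF golden_ratio_conjugates_square(2)]
    by (simp add: add_divide_distrib diff_divide_distrib)
qed (simp_all add: golden_ratio_def field_simps)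

text \<open>The conjugate root is -1/\<alpha>, and an even exponent removes the sign.\<close>

lemma golden_conjugate_powi_even:
  assumes "even n"
  shows "((1 - sqrt 5) / 2) powi n = (1 / golden_ratio) powi n"
proof -
  have "(1 - sqrt 5) / 2 = - (1 / golden_ratio)"
    using golden_ratio_pos by (simp add: golden_ratio_def field_simps)
  then show ?thesis using assms by simp
qed

lemma
  assumes "even r"
  shows lucasZ_even_multiple: "real_of_int (lucasZ (r * int k)) = (golden_ratio powi r) ^ k + (1 / golden_ratio powi r) ^ k"
    and fibZ_even_multiple: "real_of_int (fibZ (r * int k)) = ((golden_ratio powi r) ^ k - (1 / golden_ratio powi r) ^ k) / sqrt 5"
proof -
  have pow: "golden_ratio powi (r * int k) = (golden_ratio powi r) ^ k"
    by (simp add: power_int_mult)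
  have "((1 - sqrt 5) / 2) powi (r * int k) = (1 / golden_ratio powi r) ^ k"
    using assms golden_conjugate_powi_even[of "r * int k"]
    by (simp add: pow power_int_one_over power_one_over)
  then show "real_of_int (lucasZ (r * int k)) = (golden_ratio powi r) ^ k + (1 / golden_ratio powi r) ^ k"
    and "real_of_int (fibZ (r * int k)) = ((golden_ratio powi r) ^ k - (1 / golden_ratio powi r) ^ k) / sqrt 5"
    by (simp_all add: lucasZ_Binet fibZ_Binet pow)
qed

section \<open>Specialisation to Lucas and Fibonacci numbers\<close>

theorem theorem11:
  fixes m :: nat and r :: int
  assumes "even r"
  shows "((\<lambda>x::real.
            ln x * (\<Sum>j=0..m+1. real ((m+1) choose j) * real_of_int (lucasZ (2 * r * int j)) * x ^ (2*m+1-j))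
            / ((x - 1) * (x\<^sup>2 + real_of_int (lucasZ (2*r)) * x + 1) ^ (m+1)))
          has_integral
           (real_of_int (lucasZ (r * (int m + 1))) / (2 * real_of_int (lucasZ r) ^ (m+1))
              * (pi\<^sup>2 + 4 * (real_of_int r)\<^sup>2 * (ln golden_ratio)\<^sup>2)
            + 1 / real_of_int (lucasZ r) ^ m
              * (\<Sum>j<m. real_of_int (lucasZ r) ^ j / (real j + 1)
                  * (real_of_int (lucasZ (r * (int m - int j))) * harm j
                     - 2 * sqrt 5 * real_of_int r * ln golden_ratio
                       * real_of_int (fibZ (r * (int m - int j)))))))
          {0<..}
       \<and> ((\<lambda>x::real.
            ln x * (\<Sum>j=0..m+1. real ((m+1) choose j) * real_of_int (fibZ (2 * r * int j)) * x ^ (2*m+1-j))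
            / ((x - 1) * (x\<^sup>2 + real_of_int (lucasZ (2*r)) * x + 1) ^ (m+1)))
          has_integral
           (real_of_int (fibZ (r * (int m + 1))) / (2 * real_of_int (lucasZ r) ^ (m+1))
              * (pi\<^sup>2 + 4 * (real_of_int r)\<^sup>2 * (ln golden_ratio)\<^sup>2)
            + 1 / real_of_int (lucasZ r) ^ m
              * (\<Sum>j<m. real_of_int (lucasZ r) ^ j / (real j + 1)
                  * (real_of_int (fibZ (r * (int m - int j))) * harm j
                     - 2 * sqrt 5 / 5 * real_of_int r * ln golden_ratio
                       * real_of_int (lucasZ (r * (int m - int j)))))))
          {0<..}"
proof -
  \<comment> \<open>Since ln A = r ln \<alpha>, the number \<open>l\<close> is the logarithm of A^2
    and its square is the term 4 r^2 (ln \<alpha>)^2.\<close>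
  define A where "A = golden_ratio powi r"
  define l where "l = 2 * real_of_int r * ln golden_ratio"
  have A: "0 < A" by (simp add: A_def golden_ratio_pos)
  have lA: "l = 2 * ln A"
    using golden_ratio_pos by (simp add: l_def A_def flip: powr_real_of_int')
  have l2: "4 * (real_of_int r)\<^sup>2 * (ln golden_ratio)\<^sup>2 = l\<^sup>2"
    by (simp add: l_def power_mult_distrib)
  note lucas = lucasZ_even_multiple[OF assms, folded A_def] and fib = fibZ_even_multiple[OF assms, folded A_def]
  have Lr: "real_of_int (lucasZ r) = A + 1 / A" using lucas[of 1] by simp
  have L2r: "real_of_int (lucasZ (2 * r)) = A ^ 2 + (1/A) ^ 2" using lucas[of 2] by (simp add: mult.commute)
  have idx: "2 * r * int j = r * int (2 * j)" "r * (int m + 1) = r * int (m + 1)" for j by simp_all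
  \<comment> \<open>The statement subtracts indices in the integers, the kernel lemma in the
    naturals; the two agree because j < m.\<close>
  have diff: "r * (int m - int j) = r * int (m - j)" if "j < m" for j using that by (simp add: of_nat_diff)
  have lucas_diff: "real_of_int (lucasZ (r * (int m - int j))) = A ^ (m - j) + (1/A) ^ (m - j)"
    and fib_diff: "real_of_int (fibZ (r * (int m - int j))) = (A ^ (m - j) - (1/A) ^ (m - j)) / sqrt 5"
    if "j < m" for j
    using that by (simp_all only: diff lucas fib)
  show ?thesis
  proof
    \<comment> \<open>The difference A^k - (1/A)^k is sqrt 5 F_(rk), which is how Fibonacci numbers
      enter the Lucas formula.\<close>
    have S: "(\<Sum>j<m. (A + 1/A) ^ j / (real j + 1) * (real_of_int (lucasZ (r * (int m - int j))) * harm j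
         - 2 * sqrt 5 * real_of_int r * ln golden_ratio * real_of_int (fibZ (r * (int m - int j)))))
      = (\<Sum>j<m. (A + 1/A) ^ j / (real j + 1) *
             ((1 * A ^ (m-j) + 1 * (1/A) ^ (m-j)) * harm j - l * (1 * A ^ (m-j) - 1 * (1/A) ^ (m-j))))"
      by (intro sum.cong) (auto simp: lucas_diff fib_diff l_def)
    show "((\<lambda>x::real.
            ln x * (\<Sum>j=0..m+1. real ((m+1) choose j) * real_of_int (lucasZ (2 * r * int j)) * x ^ (2*m+1-j))
            / ((x - 1) * (x\<^sup>2 + real_of_int (lucasZ (2*r)) * x + 1) ^ (m+1)))
          has_integral
           (real_of_int (lucasZ (r * (int m + 1))) / (2 * real_of_int (lucasZ r) ^ (m+1))
              * (pi\<^sup>2 + 4 * (real_of_int r)\<^sup>2 * (ln golden_ratio)\<^sup>2)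
            + 1 / real_of_int (lucasZ r) ^ m
              * (\<Sum>j<m. real_of_int (lucasZ r) ^ j / (real j + 1)
                  * (real_of_int (lucasZ (r * (int m - int j))) * harm j
                     - 2 * sqrt 5 * real_of_int r * ln golden_ratio
                       * real_of_int (fibZ (r * (int m - int j)))))))
          {0<..}"
      using has_integral_ln_binomial_kernel[OF A lA, of m 1 1]
      unfolding Lr L2r S idx lucas l2 by (simp only: mult_1)
  next
    \<comment> \<open>With opposite coefficients the difference becomes (A^k + (1/A)^k)/sqrt 5, a
      Lucas number over sqrt 5; the constant agrees because 2 sqrt 5/5 = 2/sqrt 5.\<close>
    have S: "(\<Sum>j<m. (A + 1/A) ^ j / (real j + 1) * (real_of_int (fibZ (r * (int m - int j))) * harm j
         - 2 * sqrt 5 / 5 * real_of_int r * ln golden_ratio * real_of_int (lucasZ (r * (int m - int j)))))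
      = (\<Sum>j<m. (A + 1/A) ^ j / (real j + 1) *
             ((1 / sqrt 5 * A ^ (m-j) + (- 1 / sqrt 5) * (1/A) ^ (m-j)) * harm j - l * (1 / sqrt 5 * A ^ (m-j) - (- 1 / sqrt 5) * (1/A) ^ (m-j))))"
    proof (rule sum.cong)
      fix j assume "j \<in> {..<m}"
      moreover have "2 * sqrt 5 / 5 * real_of_int r * ln golden_ratio = l / sqrt 5"
        by (simp add: l_def field_simps)
      ultimately show "(A + 1/A) ^ j / (real j + 1) * (real_of_int (fibZ (r * (int m - int j))) * harm j
         - 2 * sqrt 5 / 5 * real_of_int r * ln golden_ratio * real_of_int (lucasZ (r * (int m - int j))))
        = (A + 1/A) ^ j / (real j + 1) *
             ((1 / sqrt 5 * A ^ (m-j) + (- 1 / sqrt 5) * (1/A) ^ (m-j)) * harm j - l * (1 / sqrt 5 * A ^ (m-j) - (- 1 / sqrt 5) * (1/A) ^ (m-j)))"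
        by (simp add: lucas_diff fib_diff diff_divide_distrib add_divide_distrib distrib_left)
    qed auto
    have F: "real_of_int (fibZ (r * int k)) = 1 / sqrt 5 * A ^ k + (- 1 / sqrt 5) * (1/A) ^ k" for k
      by (simp add: fib diff_divide_distrib)
    show "((\<lambda>x::real.
            ln x * (\<Sum>j=0..m+1. real ((m+1) choose j) * real_of_int (fibZ (2 * r * int j)) * x ^ (2*m+1-j))
            / ((x - 1) * (x\<^sup>2 + real_of_int (lucasZ (2*r)) * x + 1) ^ (m+1)))
          has_integral
           (real_of_int (fibZ (r * (int m + 1))) / (2 * real_of_int (lucasZ r) ^ (m+1))
              * (pi\<^sup>2 + 4 * (real_of_int r)\<^sup>2 * (ln golden_ratio)\<^sup>2)
            + 1 / real_of_int (lucasZ r) ^ m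
              * (\<Sum>j<m. real_of_int (lucasZ r) ^ j / (real j + 1)
                  * (real_of_int (fibZ (r * (int m - int j))) * harm j
                     - 2 * sqrt 5 / 5 * real_of_int r * ln golden_ratio
                       * real_of_int (lucasZ (r * (int m - int j)))))))
          {0<..}"
      using has_integral_ln_binomial_kernel[OF A lA, of m "1 / sqrt 5" "- 1 / sqrt 5"]
      unfolding Lr L2r S idx F l2 .
  qed
qed

end
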